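(* For every $p>1$, the space $(\mathcal E^p,\|\cdot\|_{\mathcal E^p})$ is a Banach space.
   Context: $C([0,1])$ denotes the real-valued continuous functions on $[0,1]$, $\|\cdot\|_\infty$ the uniform norm. $\mathbb N_0=\{0,1,2,\dots\}$, $\mathbb N_{-1}=\{-1,0,1,\dots\}$. For $n\in\mathbb N_0$: $t_{n,k}=k2^{-n}$ for $0\le k\le 2^n$, $I_n=\{0,\dots,2^n-1\}$. Faber--Schauder coefficients of $f\in C([0,1])$: $\theta^f_{-1,0}=f(1)-f(0)$, and for $n\ge0$, $k\in I_n$, $\theta^f_{n,k}=2^{n/2}\big(2f(t_{n+1,2k+1})-f(t_{n,k})-f(t_{n,k+1})\big)$. Level energies ($p>1$): $\zeta_f^{(p)}=(\zeta_f^{(p)}(n))_{n\in\mathbb N_{-1}}$ with $\zeta_f^{(p)}(-1)=2^{1-\frac1p}|\theta^f_{-1,0}|$ and $\zeta_f^{(p)}(n)=\big(2^{-np/2}\sum_{k\in I_n}|\theta^f_{n,k}|^p\big)^{1/p}$ for $n\ge0$. Schauder tail sequence: $H_f(n)=\sum_{m=n}^\infty 2^{-m/2}\sup_{k\in I_m}|\theta^f_{m,k}|\in[0,\infty]$ for $n\ge0$. Energy space ($p>1$): $\|f\|_{\mathcal E^p}=\|f\|_\infty+\|\zeta_f^{(p)}\|_{\ell^p(\mathbb N_{-1})}+\|H_f\|_{\ell^p(\mathbb N_0)}$ and $\mathcal E^p=\{f\in C([0,1]):\|f\|_{\mathcal E^p}<\infty\}$. *)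

theory Defs
  imports "HOL-Analysis.Analysis"
begin

section \<open>The space $C([0,1])$\<close>

typedef unit_interval = "{0..1::real}"
  morphisms point_of Unit_interval
  by (rule exI[of _ 0]) simp

instantiation unit_interval :: metric_space
begin

definition dist_unit_interval :: "unit_interval \<Rightarrow> unit_interval \<Rightarrow> real" where
  "dist_unit_interval x y = dist (point_of x) (point_of y)"

definition uniformity_unit_interval :: "(unit_interval \<times> unit_interval) filter" where
  "uniformity_unit_interval = (INF e\<in>{0<..}. principal {(x, y). dist x y < e})"

definition open_unit_interval :: "unit_interval set \<Rightarrow> bool" where
  "open_unit_interval S = (\<forall>x\<in>S. \<forall>\<^sub>F (x', y) in uniformity. x' = x \<longrightarrow> y \<in> S)"

instance
proof
  fix x y z :: unit_interval
  show "dist x y = 0 \<longleftrightarrow> x = y"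
    by (simp add: dist_unit_interval_def point_of_inject)
  show "dist x y \<le> dist x z + dist y z"
    unfolding dist_unit_interval_def by (rule dist_triangle2)
qed (simp_all add: uniformity_unit_interval_def open_unit_interval_def)

end

text \<open>Since the unit interval is compact, continuous functions on it are bounded, so the library
  type of bounded continuous functions, whose norm is the uniform norm, is $C([0,1])$;
  see \<open>C01_exists\<close> and \<open>continuous_on_value\<close> below.\<close>

type_synonym C01 = "unit_interval \<Rightarrow>\<^sub>C real"

text \<open>Only meant for $t \in [0,1]$.\<close>

definition value_at :: "C01 \<Rightarrow> real \<Rightarrow> real" where
  "value_at f t = apply_bcontfun f (Unit_interval t)"

lemma continuous_on_point_of: "continuous_on UNIV point_of"
  by (auto simp: continuous_on_iff dist_unit_interval_def)

lemma continuous_on_Unit_interval: "continuous_on {0..1} Unit_interval"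
  by (auto simp: continuous_on_iff dist_unit_interval_def Unit_interval_inverse)

lemma continuous_on_value: "continuous_on {0..1} (value_at f)"
  unfolding value_at_def
  by (rule continuous_on_compose2[OF continuous_on_apply_bcontfun continuous_on_Unit_interval])
     auto

lemma C01_exists:
  assumes "continuous_on {0..1} g"
  shows "\<exists>!f :: C01. \<forall>t\<in>{0..1}. value_at f t = g t"
proof (rule ex_ex1I)
  have "continuous_on UNIV (g \<circ> point_of)"
    using assms point_of
    by (intro continuous_on_compose continuous_on_point_of)
       (auto intro: continuous_on_subset)
  moreover have "range (g \<circ> point_of) \<subseteq> g ` {0..1}"
    using point_of by auto
  then have "bounded (range (g \<circ> point_of))"
    using compact_imp_bounded[OF compact_continuous_image[OF assms compact_Icc]]
      bounded_subset by blast
  ultimately have "g \<circ> point_of \<in> bcontfun"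
    by (simp add: bcontfun_def)
  then show "\<exists>f :: C01. \<forall>t\<in>{0..1}. value_at f t = g t"
    by (intro exI[of _ "Bcontfun (g \<circ> point_of)"])
       (auto simp: value_at_def Bcontfun_inverse Unit_interval_inverse)
next
  fix f h :: C01
  assume "\<forall>t\<in>{0..1}. value_at f t = g t" "\<forall>t\<in>{0..1}. value_at h t = g t"
  then have "\<forall>t\<in>{0..1}. value_at f t = value_at h t"
    by simp
  then show "f = h"
    by (intro bcontfun_eqI) (metis value_at_def point_of point_of_inverse)
qed

section \<open>Banach spaces carried by a subset of a real vector space\<close>

definition banach_space_on :: "'a::real_vector set \<Rightarrow> ('a \<Rightarrow> real) \<Rightarrow> bool" where
  "banach_space_on V N \<longleftrightarrow>
     subspace V \<and>
     (\<forall>v\<in>V. 0 \<le> N v) \<and>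
     (\<forall>v\<in>V. N v = 0 \<longleftrightarrow> v = 0) \<and>
     (\<forall>c. \<forall>v\<in>V. N (c *\<^sub>R v) = \<bar>c\<bar> * N v) \<and>
     (\<forall>v\<in>V. \<forall>w\<in>V. N (v + w) \<le> N v + N w) \<and>
     (\<forall>\<sigma> :: nat \<Rightarrow> 'a. range \<sigma> \<subseteq> V \<longrightarrow>
        (\<forall>e>0. \<exists>M. \<forall>m\<ge>M. \<forall>n\<ge>M. N (\<sigma> m - \<sigma> n) < e) \<longrightarrow>
        (\<exists>v\<in>V. (\<lambda>n. N (\<sigma> n - v)) \<longlonglongrightarrow> 0))"

section \<open>The energy space\<close>

text \<open>\<open>\<infinity> powr a = \<infinity>\<close> is the intended convention for \<open>a > 0\<close>, the only case used.\<close>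

definition ennreal_powr :: "ennreal \<Rightarrow> real \<Rightarrow> ennreal" where
  "ennreal_powr x a = (if x = \<infinity> then \<infinity> else ennreal (enn2real x powr a))"

definition lp_norm :: "real \<Rightarrow> 'i set \<Rightarrow> ('i \<Rightarrow> ennreal) \<Rightarrow> ennreal" where
  "lp_norm p A a = ennreal_powr (\<Sum>\<^sub>\<infinity>n\<in>A. ennreal_powr (a n) p) (1 / p)"

definition dyadic :: "nat \<Rightarrow> nat \<Rightarrow> real" where
  "dyadic n k = real k / 2 ^ n"

text \<open>The level \<open>n\<close> ranges over the integers \<open>n \<ge> -1\<close>; at level \<open>-1\<close> only the position
  \<open>k = 0\<close> is used.\<close>

definition schauder_coeff :: "C01 \<Rightarrow> int \<Rightarrow> nat \<Rightarrow> real" where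
  "schauder_coeff f n k =
     (if n = -1 then value_at f 1 - value_at f 0
      else 2 powr (real_of_int n / 2) *
        (2 * value_at f (dyadic (nat n + 1) (2 * k + 1))
           - value_at f (dyadic (nat n) k) - value_at f (dyadic (nat n) (k + 1))))"

definition level_energy :: "real \<Rightarrow> C01 \<Rightarrow> int \<Rightarrow> real" where
  "level_energy p f n =
     (if n = -1 then 2 powr (1 - 1 / p) * \<bar>schauder_coeff f (-1) 0\<bar>
      else (2 powr (- (real_of_int n * p / 2)) *
              (\<Sum>k<2 ^ nat n. \<bar>schauder_coeff f n k\<bar> powr p)) powr (1 / p))"

definition schauder_tail :: "C01 \<Rightarrow> nat \<Rightarrow> ennreal" where
  "schauder_tail f n =
     (\<Sum>\<^sub>\<infinity>m\<in>{n..}. ennreal (2 powr (- (real m / 2)) *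
        (SUP k\<in>{..<2 ^ m}. \<bar>schauder_coeff f (int m) k\<bar>)))"

definition energy_ennorm :: "real \<Rightarrow> C01 \<Rightarrow> ennreal" where
  "energy_ennorm p f =
     ennreal (norm f)
     + lp_norm p {-1..} (\<lambda>n. ennreal (level_energy p f n))
     + lp_norm p UNIV (schauder_tail f)"

definition energy_space :: "real \<Rightarrow> C01 set" where
  "energy_space p = {f. energy_ennorm p f < \<infinity>}"

definition energy_norm :: "real \<Rightarrow> C01 \<Rightarrow> real" where
  "energy_norm p f = enn2real (energy_ennorm p f)"

end

theory Submission
  imports Defs
begin

text \<open>The first part of the energy norm is the uniform norm. The other two are built from the
  functionals
  \<open>f \<mapsto> c * \<bar>\<theta> f\<bar>\<close>, where \<open>\<theta>\<close> is a Schauder coefficient, by suprema and \<open>\<ell>\<^sup>q\<close> norms. Indeed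
  \<open>\<zeta>\<^sub>f(n)\<close> is the \<open>\<ell>\<^sup>p\<close> norm over \<open>k\<close> of the numbers \<open>2\<^bsup>-n/2\<^esup> \<bar>\<theta>\<^bsub>n,k\<^esub>\<bar>\<close>, and the tail \<open>H\<^sub>f(n)\<close> is an
  \<open>\<ell>\<^sup>1\<close> norm of suprema of such numbers. A Schauder coefficient is a combination of point
  values, so it is a bounded linear functional of \<open>f\<close>, and its absolute value is a continuous seminorm.

  Suprema and \<open>\<ell>\<^sup>q\<close> norms turn continuous seminorms into functionals that may take the value
  \<open>\<infinity>\<close> and may be discontinuous. What they preserve is homogeneity, the triangle inequality and
  lower semicontinuity under uniform convergence. For suprema this is immediate; for \<open>\<ell>\<^sup>q\<close> norms
  over finite sets it is Minkowski's inequality (\<open>minkowski_real\<close>) and Fatou's lemma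
  (\<open>sum_liminf_le_liminf_sum\<close>); and an \<open>\<ell>\<^sup>q\<close> norm over an infinite set is the supremum of those
  over its finite subsets (\<open>lp_norm_SUP_finite\<close>). Hence the energy norm is a lower
  semicontinuous extended seminorm (\<open>lsc_seminorm_energy_ennorm\<close>).

  Such a functional \<open>Q\<close>, if it dominates the norm of a complete space, is a Banach norm on the
  subspace where it is finite (\<open>banach_space_on_lsc_seminorm\<close>): a \<open>Q\<close>-Cauchy sequence converges
  in the original norm, and lower semicontinuity lets \<open>m\<close> tend to infinity in
  \<open>Q (\<sigma> n - \<sigma> m) \<le> \<epsilon>\<close>, which gives convergence in \<open>Q\<close> to the same limit.\<close>

section \<open>Powers and \<open>\<ell>\<^sup>p\<close> norms of extended nonnegative reals\<close>

lemma ennreal_powr_ennreal: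
  "0 \<le> x \<Longrightarrow> ennreal_powr (ennreal x) a = ennreal (x powr a)"
  by (simp add: ennreal_powr_def)

lemma ennreal_powr_one [simp]: "ennreal_powr x 1 = x"
  by (cases x) (simp_all add: ennreal_powr_def)

text \<open>A positive power is an order isomorphism of \<open>[0,\<infinity>]\<close>, with the reciprocal power as its
  inverse. In this form it shows that powers commute with suprema and lower limits.\<close>

lemma ennreal_powr_le_iff:
  assumes "0 < a"
  shows "ennreal_powr x a \<le> y \<longleftrightarrow> x \<le> ennreal_powr y (1 / a)"
proof (cases x; cases y)
  fix r s :: real
  assume rs: "0 \<le> r" "x = ennreal r" "0 \<le> s" "y = ennreal s"
  have "r powr a \<le> s \<longleftrightarrow> r \<le> s powr (1 / a)"
  proof
    assume "r powr a \<le> s"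
    then have "(r powr a) powr (1 / a) \<le> s powr (1 / a)"
      using assms by (intro powr_mono2) auto
    then show "r \<le> s powr (1 / a)"
      using assms rs by (simp add: powr_powr)
  next
    assume "r \<le> s powr (1 / a)"
    then have "r powr a \<le> (s powr (1 / a)) powr a"
      using assms rs by (intro powr_mono2) auto
    then show "r powr a \<le> s"
      using assms rs by (simp add: powr_powr)
  qed
  then show ?thesis
    using rs by (simp add: ennreal_powr_ennreal)
qed (auto simp: ennreal_powr_def top_unique)

lemma le_ennreal_powr_iff:
  assumes "0 < a"
  shows "x \<le> ennreal_powr y a \<longleftrightarrow> ennreal_powr x (1 / a) \<le> y"
  using ennreal_powr_le_iff[of "1 / a" x y] assms by simp

lemma ennreal_powr_mono:
  assumes "0 < a" "x \<le> y"
  shows "ennreal_powr x a \<le> ennreal_powr y a"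
  using assms ennreal_powr_le_iff le_ennreal_powr_iff order_trans by (metis order_refl)

lemma ennreal_powr_SUP:
  assumes "0 < a"
  shows "ennreal_powr (SUP i\<in>I. x i) a = (SUP i\<in>I. ennreal_powr (x i) a)"
proof (rule antisym)
  have "x i \<le> ennreal_powr (SUP i\<in>I. ennreal_powr (x i) a) (1 / a)" if "i \<in> I" for i
    unfolding ennreal_powr_le_iff[OF assms, symmetric] by (rule SUP_upper) fact
  then show "ennreal_powr (SUP i\<in>I. x i) a \<le> (SUP i\<in>I. ennreal_powr (x i) a)"
    unfolding ennreal_powr_le_iff[OF assms] by (rule SUP_least)
  show "(SUP i\<in>I. ennreal_powr (x i) a) \<le> ennreal_powr (SUP i\<in>I. x i) a"
    by (intro SUP_least ennreal_powr_mono assms SUP_upper)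
qed

lemma ennreal_powr_mult:
  assumes "0 < a" "0 \<le> c"
  shows "ennreal_powr (ennreal c * x) a = ennreal (c powr a) * ennreal_powr x a"
proof (cases x)
  case (real r)
  then show ?thesis
    using assms by (simp add: ennreal_powr_ennreal powr_mult flip: ennreal_mult)
next
  case top
  then show ?thesis
    using assms
    by (cases "c = 0") (auto simp: ennreal_powr_def ennreal_mult_top)
qed

lemma ennreal_powr_Liminf:
  assumes "0 < a"
  shows "ennreal_powr (Liminf F X) a \<le> Liminf F (\<lambda>k. ennreal_powr (X k) a)"
proof -
  have less: "y < ennreal_powr x a \<longleftrightarrow> ennreal_powr y (1 / a) < x" for x y
    using ennreal_powr_le_iff[OF assms, of x y] by (simp add: not_le[symmetric])
  show ?thesis
    unfolding le_Liminf_iff less using less_LiminfD by blast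
qed

text \<open>This reduces every question about infinite index sets to finite ones.\<close>

lemma lp_norm_SUP_finite:
  assumes "0 < p"
  shows "lp_norm p A a = (SUP F\<in>{F. finite F \<and> F \<subseteq> A}. lp_norm p F a)"
proof -
  have "(\<Sum>\<^sub>\<infinity>n\<in>A. ennreal_powr (a n) p) =
      (SUP F\<in>{F. finite F \<and> F \<subseteq> A}. \<Sum>n\<in>F. ennreal_powr (a n) p)"
    by (rule nonneg_infsum_complete) simp
  then show ?thesis
    using assms by (simp add: lp_norm_def ennreal_powr_SUP)
qed

lemma lp_norm_one: "lp_norm 1 A a = (\<Sum>\<^sub>\<infinity>n\<in>A. a n)"
  by (simp add: lp_norm_def)

lemma lp_norm_ennreal:
  assumes "finite F" "\<And>n. n \<in> F \<Longrightarrow> 0 \<le> x n"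
  shows "lp_norm p F (\<lambda>n. ennreal (x n)) = ennreal ((\<Sum>n\<in>F. x n powr p) powr (1 / p))"
proof -
  have "(\<Sum>n\<in>F. ennreal_powr (ennreal (x n)) p) = ennreal (\<Sum>n\<in>F. x n powr p)"
    using assms by (simp add: ennreal_powr_ennreal sum_ennreal)
  then show ?thesis
    using assms by (simp add: lp_norm_def ennreal_powr_ennreal sum_nonneg)
qed

lemma member_le_lp_norm:
  assumes "0 < p" "finite F" "n \<in> F"
  shows "a n \<le> lp_norm p F a"
proof -
  have "ennreal_powr (a n) p \<le> (\<Sum>n\<in>F. ennreal_powr (a n) p)"
    using assms by (intro member_le_sum) auto
  then show ?thesis
    using assms by (simp add: lp_norm_def le_ennreal_powr_iff)
qed

lemma lp_norm_mono:
  assumes "0 < p" "finite F" "\<And>n. n \<in> F \<Longrightarrow> a n \<le> b n"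
  shows "lp_norm p F a \<le> lp_norm p F b"
  using assms by (auto simp: lp_norm_def intro!: ennreal_powr_mono sum_mono)

lemma lp_norm_cong:
  "(\<And>n. n \<in> A \<Longrightarrow> a n = b n) \<Longrightarrow> lp_norm p A a = lp_norm p A b"
  by (simp add: lp_norm_def cong: infsum_cong)

lemma lp_norm_mult:
  assumes "0 < p" "finite F" "0 \<le> c"
  shows "lp_norm p F (\<lambda>n. ennreal c * a n) = ennreal c * lp_norm p F a"
  using assms
  by (simp add: lp_norm_def ennreal_powr_mult powr_powr flip: sum_distrib_left)

text \<open>Convexity of \<open>x \<mapsto> x\<^sup>p\<close> on the closed half line: at the endpoint \<open>0\<close> it becomes
  \<open>w\<^sup>p \<le> w\<close> for a weight \<open>w \<le> 1\<close>.\<close>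

lemma powr_convex_combination_le:
  fixes p x y u v :: real
  assumes "1 \<le> p" "0 \<le> x" "0 \<le> y" "0 \<le> u" "0 \<le> v" "u + v = 1"
  shows "(u * x + v * y) powr p \<le> u * x powr p + v * y powr p"
proof -
  have shrink: "(w * z) powr p \<le> w * z powr p" if "0 \<le> w" "w \<le> 1" "0 \<le> z" for w z :: real
  proof -
    have "w powr p \<le> w"
      using powr_mono'[of 1 p w] that assms by simp
    then show ?thesis
      using that by (simp add: powr_mult mult_right_mono)
  qed
  show ?thesis
  proof (cases "x = 0 \<or> y = 0")
    case True
    then show ?thesis
      using shrink[of u x] shrink[of v y] assms by auto
  next
    case False
    then have "(u *\<^sub>R x + v *\<^sub>R y) powr p \<le> u * x powr p + v * y powr p"
      using powr_convex[OF \<open>1 \<le> p\<close>] assms by (auto simp: convex_on_def)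
    then show ?thesis by simp
  qed
qed

text \<open>Minkowski's inequality. With \<open>A\<close> and \<open>B\<close> the norms of \<open>x\<close> and \<open>y\<close>, the vector
  \<open>(x + y) / (A + B)\<close> is the convex combination of the unit vectors \<open>x / A\<close> and \<open>y / B\<close> with
  weights \<open>A / (A + B)\<close> and \<open>B / (A + B)\<close>; convexity of the \<open>p\<close>-th power in each entry then shows
  that its norm is at most \<open>1\<close>.\<close>

lemma minkowski_real:
  fixes x y :: "'i \<Rightarrow> real" and p :: real
  assumes "1 \<le> p" "finite F" and x: "\<And>n. n \<in> F \<Longrightarrow> 0 \<le> x n" and y: "\<And>n. n \<in> F \<Longrightarrow> 0 \<le> y n"
  shows "(\<Sum>n\<in>F. (x n + y n) powr p) powr (1 / p)
    \<le> (\<Sum>n\<in>F. x n powr p) powr (1 / p) + (\<Sum>n\<in>F. y n powr p) powr (1 / p)"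
    (is "?C powr _ \<le> ?X powr _ + ?Y powr _")
proof (cases "?X = 0 \<or> ?Y = 0")
  case True
  then have "(\<forall>n\<in>F. x n = 0) \<or> (\<forall>n\<in>F. y n = 0)"
    using \<open>finite F\<close> by (auto simp: sum_nonneg_eq_0_iff)
  then show ?thesis
    by auto
next
  case False
  define A B where "A = ?X powr (1 / p)" and "B = ?Y powr (1 / p)"
  define S where "S = A + B"
  have "0 < ?X" "0 < ?Y"
    using False by (auto simp: order_less_le sum_nonneg)
  then have pos: "0 < A" "0 < B" "0 < S" and pow: "A powr p = ?X" "B powr p = ?Y"
    using \<open>1 \<le> p\<close> by (auto simp: A_def B_def S_def powr_powr add_pos_pos)
  have "((x n + y n) / S) powr p \<le> A / S * (x n / A) powr p + B / S * (y n / B) powr p"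
    if "n \<in> F" for n
  proof -
    have "A / S + B / S = 1"
      using pos by (simp add: S_def flip: add_divide_distrib)
    then have "(A / S * (x n / A) + B / S * (y n / B)) powr p
        \<le> A / S * (x n / A) powr p + B / S * (y n / B) powr p"
      using assms that pos by (intro powr_convex_combination_le) auto
    then show ?thesis
      using pos by (simp add: add_divide_distrib)
  qed
  then have "(\<Sum>n\<in>F. ((x n + y n) / S) powr p)
      \<le> (\<Sum>n\<in>F. A / S * (x n / A) powr p + B / S * (y n / B) powr p)"
    by (rule sum_mono)
  also have "\<dots> = A / S * (?X / A powr p) + B / S * (?Y / B powr p)"
    using x y pos
    by (simp add: powr_divide sum.distrib flip: sum_distrib_left sum_divide_distrib)
  also have "\<dots> = 1"
    using pos \<open>0 < ?X\<close> \<open>0 < ?Y\<close> by (simp add: pow S_def flip: add_divide_distrib)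
  finally have "?C / S powr p \<le> 1"
    using x y pos by (simp add: powr_divide flip: sum_divide_distrib)
  then have "?C \<le> S powr p"
    using pos by (simp add: divide_le_eq)
  then have "?C powr (1 / p) \<le> (S powr p) powr (1 / p)"
    using \<open>1 \<le> p\<close> by (intro powr_mono2) (auto intro: sum_nonneg)
  then show ?thesis
    using \<open>1 \<le> p\<close> pos by (simp add: powr_powr S_def A_def B_def)
qed

lemma lp_norm_add_le:
  assumes "1 \<le> p" "finite F"
  shows "lp_norm p F (\<lambda>n. a n + b n) \<le> lp_norm p F a + lp_norm p F b"
proof (cases "\<exists>n\<in>F. a n = top \<or> b n = top")
  case True
  then have "lp_norm p F a = top \<or> lp_norm p F b = top"
    using member_le_lp_norm[of p F _ a] member_le_lp_norm[of p F _ b] assms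
    by (metis less_le_trans top_unique zero_less_one)
  then show ?thesis
    by auto
next
  case False
  define x y where "x n = enn2real (a n)" and "y n = enn2real (b n)" for n
  have nonneg: "0 \<le> x n" "0 \<le> y n" for n
    by (simp_all add: x_def y_def)
  have finite: "a n = ennreal (x n)" "b n = ennreal (y n)" if "n \<in> F" for n
    using False that by (auto simp: x_def y_def less_top)
  have "lp_norm p F (\<lambda>n. a n + b n) = lp_norm p F (\<lambda>n. ennreal (x n + y n))"
    by (rule lp_norm_cong) (simp add: finite nonneg)
  moreover have "lp_norm p F a = lp_norm p F (\<lambda>n. ennreal (x n))"
    "lp_norm p F b = lp_norm p F (\<lambda>n. ennreal (y n))"
    by (auto intro: lp_norm_cong finite)
  ultimately show ?thesis
    using minkowski_real[OF assms, of x y] nonneg \<open>finite F\<close>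
    by (simp add: lp_norm_ennreal flip: ennreal_plus)
qed

text \<open>Fatou's lemma for the counting measure.\<close>

lemma sum_liminf_le_liminf_sum:
  fixes a :: "'i \<Rightarrow> nat \<Rightarrow> ennreal"
  assumes "finite F"
  shows "(\<Sum>n\<in>F. liminf (a n)) \<le> liminf (\<lambda>k. \<Sum>n\<in>F. a n k)"
  using nn_integral_liminf[of "\<lambda>k n. a n k" "count_space F"] assms
  by (simp add: nn_integral_count_space_finite)

section \<open>Lower semicontinuous extended seminorms\<close>

text \<open>The homogeneity clause includes \<open>c = 0\<close>, where \<open>0 * \<infinity> = 0\<close> in the extended nonnegative
  reals; in particular the functional vanishes at \<open>0\<close>.\<close>

definition lsc_seminorm :: "('a::real_normed_vector \<Rightarrow> ennreal) \<Rightarrow> bool" where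
  "lsc_seminorm Q \<longleftrightarrow>
     (\<forall>c f. Q (c *\<^sub>R f) = ennreal \<bar>c\<bar> * Q f) \<and>
     (\<forall>f g. Q (f + g) \<le> Q f + Q g) \<and>
     (\<forall>X f. X \<longlonglongrightarrow> f \<longrightarrow> Q f \<le> liminf (\<lambda>k. Q (X k)))"

lemma lsc_seminormI:
  assumes "\<And>c f. Q (c *\<^sub>R f) = ennreal \<bar>c\<bar> * Q f"
    and "\<And>f g. Q (f + g) \<le> Q f + Q g"
    and "\<And>X f. X \<longlonglongrightarrow> f \<Longrightarrow> Q f \<le> liminf (\<lambda>k. Q (X k))"
  shows "lsc_seminorm Q"
  using assms by (simp add: lsc_seminorm_def)

lemma lsc_seminormD:
  assumes "lsc_seminorm Q"
  shows "Q (c *\<^sub>R f) = ennreal \<bar>c\<bar> * Q f"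
    and "Q (f + g) \<le> Q f + Q g"
    and "X \<longlonglongrightarrow> f \<Longrightarrow> Q f \<le> liminf (\<lambda>k. Q (X k))"
  using assms by (auto simp: lsc_seminorm_def)

lemma lsc_seminorm_norm_linear:
  fixes l :: "'a::real_normed_vector \<Rightarrow> 'b::real_normed_vector"
  assumes "bounded_linear l"
  shows "lsc_seminorm (\<lambda>f. ennreal (norm (l f)))"
proof (rule lsc_seminormI)
  interpret l: bounded_linear l by fact
  show "ennreal (norm (l (c *\<^sub>R f))) = ennreal \<bar>c\<bar> * ennreal (norm (l f))" for c f
    by (simp add: l.scaleR ennreal_mult)
  show "ennreal (norm (l (f + g))) \<le> ennreal (norm (l f)) + ennreal (norm (l g))" for f g
    by (simp add: l.add norm_triangle_ineq flip: ennreal_plus)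
  show "ennreal (norm (l f)) \<le> liminf (\<lambda>k. ennreal (norm (l (X k))))" if "X \<longlonglongrightarrow> f" for X f
  proof -
    have "(\<lambda>k. ennreal (norm (l (X k)))) \<longlonglongrightarrow> ennreal (norm (l f))"
      by (intro tendsto_ennrealI tendsto_norm l.tendsto that)
    then have "liminf (\<lambda>k. ennreal (norm (l (X k)))) = ennreal (norm (l f))"
      by (rule lim_imp_Liminf[OF sequentially_bot])
    then show ?thesis
      by simp
  qed
qed

lemma lsc_seminorm_SUP:
  assumes "\<And>i. i \<in> I \<Longrightarrow> lsc_seminorm (Q i)"
  shows "lsc_seminorm (\<lambda>f. SUP i\<in>I. Q i f)"
proof (rule lsc_seminormI)
  show "(SUP i\<in>I. Q i (c *\<^sub>R f)) = ennreal \<bar>c\<bar> * (SUP i\<in>I. Q i f)" for c f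
    using assms by (simp add: lsc_seminormD(1) SUP_mult_left_ennreal cong: SUP_cong)
  show "(SUP i\<in>I. Q i (f + g)) \<le> (SUP i\<in>I. Q i f) + (SUP i\<in>I. Q i g)" for f g
  proof (rule SUP_least)
    fix i assume "i \<in> I"
    then show "Q i (f + g) \<le> (SUP i\<in>I. Q i f) + (SUP i\<in>I. Q i g)"
      by (intro order_trans[OF lsc_seminormD(2)[OF assms]] add_mono SUP_upper)
  qed
  show "(SUP i\<in>I. Q i f) \<le> liminf (\<lambda>k. SUP i\<in>I. Q i (X k))" if "X \<longlonglongrightarrow> f" for X f
  proof (rule SUP_least)
    fix i assume "i \<in> I"
    then show "Q i f \<le> liminf (\<lambda>k. SUP i\<in>I. Q i (X k))"
      by (intro order_trans[OF lsc_seminormD(3)[OF assms that]] Liminf_mono always_eventually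
          allI SUP_upper)
  qed
qed

text \<open>The triangle inequality is Minkowski's. For lower semicontinuity, the power \<open>p\<close>, the sum
  and the power \<open>1 / p\<close> are monotone and each may be exchanged with the lower limit at the
  cost of an inequality in the right direction.\<close>

lemma lsc_seminorm_lp_norm_finite:
  assumes "1 \<le> p" "finite F" and Q: "\<And>n. n \<in> F \<Longrightarrow> lsc_seminorm (Q n)"
  shows "lsc_seminorm (\<lambda>f. lp_norm p F (\<lambda>n. Q n f))"
proof (rule lsc_seminormI)
  have p: "0 < p" "0 < 1 / p"
    using \<open>1 \<le> p\<close> by auto
  show "lp_norm p F (\<lambda>n. Q n (c *\<^sub>R f)) = ennreal \<bar>c\<bar> * lp_norm p F (\<lambda>n. Q n f)" for c f
  proof -
    have "lp_norm p F (\<lambda>n. Q n (c *\<^sub>R f)) = lp_norm p F (\<lambda>n. ennreal \<bar>c\<bar> * Q n f)"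
      by (rule lp_norm_cong) (simp add: lsc_seminormD(1)[OF Q])
    then show ?thesis
      using assms p by (simp add: lp_norm_mult)
  qed
  show "lp_norm p F (\<lambda>n. Q n (f + g)) \<le> lp_norm p F (\<lambda>n. Q n f) + lp_norm p F (\<lambda>n. Q n g)"
    for f g
    by (rule order_trans[OF lp_norm_mono lp_norm_add_le]) (use assms p lsc_seminormD(2) in auto)
  show "lp_norm p F (\<lambda>n. Q n f) \<le> liminf (\<lambda>k. lp_norm p F (\<lambda>n. Q n (X k)))"
    if "X \<longlonglongrightarrow> f" for X f
  proof -
    have "(\<Sum>n\<in>F. ennreal_powr (Q n f) p) \<le> (\<Sum>n\<in>F. liminf (\<lambda>k. ennreal_powr (Q n (X k)) p))"
      using p lsc_seminormD(3)[OF Q that]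
      by (intro sum_mono order_trans[OF ennreal_powr_mono ennreal_powr_Liminf]) auto
    also have "\<dots> \<le> liminf (\<lambda>k. \<Sum>n\<in>F. ennreal_powr (Q n (X k)) p)"
      by (rule sum_liminf_le_liminf_sum) fact
    finally show ?thesis
      unfolding lp_norm_def using \<open>finite F\<close> p
      by (auto intro: order_trans[OF ennreal_powr_mono ennreal_powr_Liminf])
  qed
qed

lemma lsc_seminorm_lp_norm:
  assumes "1 \<le> p" "\<And>n. n \<in> A \<Longrightarrow> lsc_seminorm (Q n)"
  shows "lsc_seminorm (\<lambda>f. lp_norm p A (\<lambda>n. Q n f))"
proof -
  have "lsc_seminorm (\<lambda>f. SUP F\<in>{F. finite F \<and> F \<subseteq> A}. lp_norm p F (\<lambda>n. Q n f))"
    using assms by (intro lsc_seminorm_SUP lsc_seminorm_lp_norm_finite) auto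
  then show ?thesis
    using assms by (subst lp_norm_SUP_finite) auto
qed

lemma lsc_seminorm_add:
  assumes "lsc_seminorm P" "lsc_seminorm Q"
  shows "lsc_seminorm (\<lambda>f. P f + Q f)"
proof -
  \<comment> \<open>a sum of two terms is an \<open>\<ell>\<^sup>1\<close> norm over a two-element index set\<close>
  have "lsc_seminorm (\<lambda>f. lp_norm 1 (UNIV :: bool set) (\<lambda>b. if b then P f else Q f))"
  proof (rule lsc_seminorm_lp_norm)
    show "lsc_seminorm (\<lambda>f. if b then P f else Q f)" for b
      using assms by (cases b) simp_all
  qed simp
  then show ?thesis
    by (simp add: lp_norm_one UNIV_bool add.commute)
qed

text \<open>The limit of a \<open>Q\<close>-Cauchy sequence is first found in the ambient norm, which \<open>Q\<close> dominates.
  Lower semicontinuity is what carries the Cauchy estimate over to that limit.\<close>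

theorem banach_space_on_lsc_seminorm:
  fixes Q :: "'a::{real_normed_vector, complete_space} \<Rightarrow> ennreal"
  assumes Q: "lsc_seminorm Q" and norm_le: "\<And>f. ennreal (norm f) \<le> Q f"
  shows "banach_space_on {f. Q f < \<infinity>} (\<lambda>f. enn2real (Q f))"
proof -
  note scale = lsc_seminormD(1)[OF Q] and add = lsc_seminormD(2)[OF Q]
  let ?V = "{f. Q f < \<infinity>}" and ?N = "\<lambda>f. enn2real (Q f)"
  have zero: "Q 0 = 0"
    using scale[of 0 0] by simp
  have V: "subspace ?V"
    unfolding subspace_def
    using zero order.strict_trans1[OF add] by (auto simp: scale ennreal_mult_less_top)
  have norm_le_N: "norm f \<le> ?N f" if "f \<in> ?V" for f
    using enn2real_mono[OF norm_le[of f]] that by simp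
  have complete: "\<exists>v\<in>?V. (\<lambda>n. ?N (\<sigma> n - v)) \<longlonglongrightarrow> 0"
    if \<sigma>: "range \<sigma> \<subseteq> ?V" and cauchy: "\<And>e. e > 0 \<Longrightarrow> \<exists>M. \<forall>m\<ge>M. \<forall>n\<ge>M. ?N (\<sigma> m - \<sigma> n) < e"
    for \<sigma> :: "nat \<Rightarrow> 'a"
  proof -
    have diff: "\<sigma> m - \<sigma> n \<in> ?V" for m n
      using \<sigma> by (intro subspace_diff[OF V]) auto
    have "Cauchy \<sigma>"
      using cauchy norm_le_N[OF diff] unfolding Cauchy_def dist_norm by (meson le_less_trans)
    then obtain v where v: "\<sigma> \<longlonglongrightarrow> v"
      using Cauchy_convergent convergent_def by blast
    have close: "\<exists>M. \<forall>n\<ge>M. Q (\<sigma> n - v) \<le> ennreal e" if "e > 0" for e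
    proof -
      obtain M where M: "\<And>m n. m \<ge> M \<Longrightarrow> n \<ge> M \<Longrightarrow> ?N (\<sigma> m - \<sigma> n) < e"
        using cauchy[OF \<open>e > 0\<close>] by blast
      have "Q (\<sigma> n - v) \<le> ennreal e" if "n \<ge> M" for n
      proof -
        have "(\<lambda>m. \<sigma> n - \<sigma> m) \<longlonglongrightarrow> \<sigma> n - v"
          by (intro tendsto_intros v)
        then have "Q (\<sigma> n - v) \<le> liminf (\<lambda>m. Q (\<sigma> n - \<sigma> m))"
          by (rule lsc_seminormD(3)[OF Q])
        also have "\<dots> \<le> liminf (\<lambda>m. ennreal e)"
        proof (intro Liminf_mono eventually_sequentiallyI[of M])
          fix m assume "M \<le> m"
          then have "ennreal (?N (\<sigma> n - \<sigma> m)) \<le> ennreal e"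
            using M[of n m] \<open>n \<ge> M\<close> by (intro ennreal_leI) auto
          then show "Q (\<sigma> n - \<sigma> m) \<le> ennreal e"
            using diff[of n m] by (simp add: less_top)
        qed
        finally show ?thesis
          by (simp add: Liminf_const)
      qed
      then show ?thesis by blast
    qed
    \<comment> \<open>one \<open>\<sigma> n\<close> at finite \<open>Q\<close>-distance from \<open>v\<close> puts \<open>v\<close> in the subspace\<close>
    obtain n where "Q (\<sigma> n - v) \<le> ennreal 1"
      using close[of 1] by auto
    then have "\<sigma> n - v \<in> ?V"
      by (auto intro: le_less_trans)
    moreover have "\<sigma> n \<in> ?V"
      using \<sigma> by auto
    ultimately have "\<sigma> n - (\<sigma> n - v) \<in> ?V"
      by (metis subspace_diff[OF V])
    then have "v \<in> ?V"
      by simp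
    moreover have "(\<lambda>n. ?N (\<sigma> n - v)) \<longlonglongrightarrow> 0"
    proof (rule LIMSEQ_I)
      fix r :: real assume "0 < r"
      then obtain M where M: "\<And>n. n \<ge> M \<Longrightarrow> Q (\<sigma> n - v) \<le> ennreal (r / 2)"
        using close[of "r / 2"] by auto
      have "?N (\<sigma> n - v) < r" if "n \<ge> M" for n
        using enn2real_mono[OF M[OF that]] \<open>0 < r\<close> by simp
      then show "\<exists>M. \<forall>n\<ge>M. norm (?N (\<sigma> n - v) - 0) < r"
        by auto
    qed
    ultimately show ?thesis by blast
  qed
  have definite: "?N f = 0 \<longleftrightarrow> f = 0" if "f \<in> ?V" for f
    using norm_le_N[OF that] zero by auto
  have triangle: "?N (f + g) \<le> ?N f + ?N g" if "f \<in> ?V" "g \<in> ?V" for f g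
    using enn2real_mono[OF add[of f g]] that by (simp add: enn2real_plus)
  show ?thesis
    unfolding banach_space_on_def
    using V definite triangle complete by (auto simp: scale enn2real_mult)
qed

section \<open>The energy norm\<close>

lemma bounded_linear_value_at: "bounded_linear (\<lambda>f. value_at f t)"
proof (rule bounded_linear_intro[where K = 1])
  show "norm (value_at f t) \<le> norm f * 1" for f
    using norm_bounded[of f] by (simp add: value_at_def)
qed (simp_all add: value_at_def)

lemma bounded_linear_schauder_coeff: "bounded_linear (\<lambda>f. schauder_coeff f n k)"
  unfolding schauder_coeff_def
  by (cases "n = -1")
     (auto intro!: bounded_linear_intros bounded_linear_value_at
        bounded_linear_compose[OF bounded_linear_mult_right])

lemma lsc_seminorm_schauder_coeff:
  "lsc_seminorm (\<lambda>f. ennreal (c * \<bar>schauder_coeff f n k\<bar>))" if "0 \<le> c"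
proof -
  have "bounded_linear (\<lambda>f. c * schauder_coeff f n k)"
    by (rule bounded_linear_const_mult) (rule bounded_linear_schauder_coeff)
  from lsc_seminorm_norm_linear[OF this] show ?thesis
    using that by (simp add: abs_mult)
qed

text \<open>The weight \<open>2\<^bsup>-np/2\<^esup>\<close> is the \<open>p\<close>-th power of \<open>2\<^bsup>-n/2\<^esup>\<close>, so it can be moved into the entries.\<close>

lemma level_energy_eq_lp_norm:
  assumes "1 \<le> p" "0 \<le> n"
  shows "ennreal (level_energy p f n) =
    lp_norm p {..<2 ^ nat n} (\<lambda>k. ennreal (2 powr (- (real_of_int n / 2)) * \<bar>schauder_coeff f n k\<bar>))"
  using assms
  by (simp add: level_energy_def lp_norm_ennreal powr_mult powr_powr flip: sum_distrib_left)

lemma lsc_seminorm_level_energy: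
  assumes "1 \<le> p" "-1 \<le> n"
  shows "lsc_seminorm (\<lambda>f. ennreal (level_energy p f n))"
proof (cases "n = -1")
  case True
  then show ?thesis
    by (simp add: level_energy_def lsc_seminorm_schauder_coeff)
next
  case False
  then have "0 \<le> n"
    using assms by simp
  then show ?thesis
    using assms
    by (simp add: level_energy_eq_lp_norm lsc_seminorm_lp_norm lsc_seminorm_schauder_coeff)
qed

lemma ennreal_mult_SUP_finite:
  fixes x :: "'i \<Rightarrow> real"
  assumes "finite I" "I \<noteq> {}" "0 \<le> c"
  shows "ennreal (c * (SUP i\<in>I. x i)) = (SUP i\<in>I. ennreal (c * x i))"
proof (rule antisym)
  have "(SUP i\<in>I. x i) \<in> x ` I"
    using assms by (simp add: cSup_eq_Max del: Max_in) (rule Max_in; simp)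
  then show "ennreal (c * (SUP i\<in>I. x i)) \<le> (SUP i\<in>I. ennreal (c * x i))"
    by (auto intro: SUP_upper)
  show "(SUP i\<in>I. ennreal (c * x i)) \<le> ennreal (c * (SUP i\<in>I. x i))"
    using assms
    by (intro SUP_least ennreal_leI mult_left_mono cSUP_upper) auto
qed

lemma lsc_seminorm_schauder_tail: "lsc_seminorm (\<lambda>f. schauder_tail f n)"
proof -
  have "lsc_seminorm (\<lambda>f. lp_norm 1 {n..} (\<lambda>m. SUP k\<in>{..<2 ^ m}.
      ennreal (2 powr (- (real m / 2)) * \<bar>schauder_coeff f (int m) k\<bar>)))"
    by (intro lsc_seminorm_lp_norm lsc_seminorm_SUP lsc_seminorm_schauder_coeff) auto
  then show ?thesis
    by (simp add: schauder_tail_def lp_norm_one ennreal_mult_SUP_finite lessThan_empty_iff)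
qed

lemma lsc_seminorm_energy_ennorm:
  assumes "1 \<le> p"
  shows "lsc_seminorm (energy_ennorm p)"
proof -
  have "lsc_seminorm (\<lambda>f :: C01. ennreal (norm f))"
    using lsc_seminorm_norm_linear[OF bounded_linear_ident] .
  then show ?thesis
    unfolding energy_ennorm_def[abs_def] using assms
    by (intro lsc_seminorm_add lsc_seminorm_lp_norm lsc_seminorm_level_energy
        lsc_seminorm_schauder_tail) auto
qed

theorem proposition3p20:
  fixes p :: real
  assumes "p > 1"
  shows "banach_space_on (energy_space p) (energy_norm p)"
proof -
  have "ennreal (norm f) \<le> energy_ennorm p f" for f
    by (simp add: energy_ennorm_def add.assoc add_increasing2)
  then have "banach_space_on {f. energy_ennorm p f < \<infinity>} (\<lambda>f. enn2real (energy_ennorm p f))"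
    using assms by (intro banach_space_on_lsc_seminorm lsc_seminorm_energy_ennorm) auto
  then show ?thesis
    by (simp add: energy_space_def energy_norm_def[abs_def])
qed

end
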